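(* For every finite simple graph $G$ with at least one edge and every field $\mathbb{F}$, the following inequality holds: $\operatorname{minrk}_{\mathbb{F}}(\overline{G})\geq\frac12\operatorname{Xind}(\operatorname{Hom}(K_2,G))+2$, where $\overline{G}$ is the complement of $G$.
   Context: Minrank: a $V\times V$ matrix $A$ with entries in a field $\mathbb{F}$ represents a graph $H=(V,E)$ over $\mathbb{F}$ if $A_{u,u}\neq 0$ for every vertex $u$ and $A_{u,v}=0$ for every two distinct nonadjacent vertices $u,v$ of $H$ ($A$ is not required to be symmetric). The minrank of $H$ over $\mathbb{F}$ is $\operatorname{minrk}_{\mathbb{F}}(H)=\min\{\operatorname{rk}_{\mathbb{F}}(A) : A \text{ represents } H \text{ over } \mathbb{F}\}$. Free $Z_2$-posets and cross-index: a free $Z_2$-poset is a poset with a fixed-point free involution $\nu$ that preserves the order. A map $\phi\colon P\to Q$ between free $Z_2$-posets is an order-preserving $Z_2$-map if it is order-preserving and $\phi(\nu\cdot p)=\nu\cdot\phi(p)$ for all $p\in P$. For an integer $n\ge 0$, $Q_n$ is the free $Z_2$-poset with elements $\{\pm1,\ldots,\pm(n+1)\}$, strict order given by $p<q$ if and only if $|p|<|q|$ (so $-i$ and $+i$ are incomparable), and involution $p\mapsto -p$. The cross-index $\operatorname{Xind}(P)$ of a nonempty free $Z_2$-poset $P$ is the minimum $n\geq 0$ such that there is an order-preserving $Z_2$-map from $P$ to $Q_n$; by convention $\operatorname{Xind}(\emptyset)=-1$. Hom complex: for a graph $G=(V,E)$, $\operatorname{Hom}(K_2,G)$ is the free $Z_2$-poset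 of all pairs $(X,Y)$ of nonempty disjoint subsets of $V$ such that every vertex of $X$ is adjacent to every vertex of $Y$, ordered by $(X,Y)\subseteq(X',Y')$ if and only if $X\subseteq X'$ and $Y\subseteq Y'$, with involution $\nu\cdot(X,Y)=(Y,X)$. *)

theory Defs
  imports "HOL-Analysis.Analysis" "Graph_Theory.Pair_Digraph"
begin

text \<open>
  A finite simple graph is a \<^locale>\<open>pair_graph\<close>: an edge between u and v is the pair
  of arcs (u, v) and (v, u).
\<close>

definition complement_graph :: "'v pair_pre_digraph \<Rightarrow> 'v pair_pre_digraph" where
  "complement_graph G =
     \<lparr> pverts = pverts G,
       parcs = {(u, v). u \<in> pverts G \<and> v \<in> pverts G \<and> u \<noteq> v \<and> (u, v) \<notin> parcs G} \<rparr>"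

lemma pair_graph_complement_graph:
  assumes "pair_graph G"
  shows "pair_graph (complement_graph G)"
proof -
  interpret pair_graph G by fact
  have "parcs (complement_graph G) \<subseteq> pverts G \<times> pverts G"
    by (auto simp: complement_graph_def)
  then have "finite (parcs (complement_graph G))"
    using pair_finite_verts finite_subset by blast
  moreover have "(u, v) \<in> parcs G \<longleftrightarrow> (v, u) \<in> parcs G" for u v
    using pair_sym_arcs by (auto simp: symmetric_def sym_def)
  ultimately show ?thesis
    using pair_finite_verts
    by unfold_locales (auto simp: complement_graph_def symmetric_def sym_def)
qed

section \<open>Minrank\<close>

text \<open>
  Matrices are indexed by the vertex type, so these two definitions are meant for graphs
  with \<^term>\<open>pverts H = UNIV\<close>.
\<close>

definition represents :: "'f::field ^ 'v ^ 'v \<Rightarrow> 'v::finite pair_pre_digraph \<Rightarrow> bool" where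
  "represents A H \<longleftrightarrow>
     (\<forall>u \<in> pverts H. A $ u $ u \<noteq> 0) \<and>
     (\<forall>u \<in> pverts H. \<forall>v \<in> pverts H. u \<noteq> v \<and> (u, v) \<notin> parcs H \<longrightarrow> A $ u $ v = 0)"

definition minrk :: "'f::field itself \<Rightarrow> 'v::finite pair_pre_digraph \<Rightarrow> nat" where
  "minrk _ H = (LEAST r. \<exists>A :: 'f ^ 'v ^ 'v. represents A H \<and> rank A = r)"

lemma represents_mat_1: "represents (mat 1) H"
  by (simp add: represents_def mat_def)

lemma minrk_attained:
  "\<exists>A :: 'f::field ^ 'v ^ 'v. represents A H \<and> rank A = minrk TYPE('f) (H :: 'v::finite pair_pre_digraph)"
  unfolding minrk_def by (rule LeastI_ex) (use represents_mat_1 in blast)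

section \<open>Free Z2-posets and the cross-index\<close>

record 'a z2poset =
  elems :: "'a set"
  leq :: "'a \<Rightarrow> 'a \<Rightarrow> bool"
  nu :: "'a \<Rightarrow> 'a"

locale free_z2poset =
  fixes P :: "'a z2poset"
  assumes refl: "reflp_on (elems P) (leq P)"
    and trans: "transp_on (elems P) (leq P)"
    and antisym: "antisymp_on (elems P) (leq P)"
    and nu_closed: "p \<in> elems P \<Longrightarrow> nu P p \<in> elems P"
    and nu_nu: "p \<in> elems P \<Longrightarrow> nu P (nu P p) = p"
    and nu_free: "p \<in> elems P \<Longrightarrow> nu P p \<noteq> p"
    and nu_mono: "monotone_on (elems P) (leq P) (leq P) (nu P)"

definition op_z2_map :: "'a z2poset \<Rightarrow> 'b z2poset \<Rightarrow> ('a \<Rightarrow> 'b) \<Rightarrow> bool" where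
  "op_z2_map P Q \<phi> \<longleftrightarrow>
     \<phi> \<in> elems P \<rightarrow> elems Q \<and>
     monotone_on (elems P) (leq P) (leq Q) \<phi> \<and>
     (\<forall>p \<in> elems P. \<phi> (nu P p) = nu Q (\<phi> p))"

definition cross_poset :: "nat \<Rightarrow> int z2poset" where
  "cross_poset n =
     \<lparr> elems = {p. 1 \<le> \<bar>p\<bar> \<and> \<bar>p\<bar> \<le> int n + 1},
       leq = (\<lambda>p q. p = q \<or> \<bar>p\<bar> < \<bar>q\<bar>),
       nu = uminus \<rparr>"

lemma free_z2poset_cross_poset: "free_z2poset (cross_poset n)"
  by unfold_locales
    (auto simp: cross_poset_def intro!: reflp_onI transp_onI antisymp_onI monotone_onI)

text \<open>
  The lemma after the definition shows that the minimum exists for every finite free Z2-poset.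
  For an infinite one it need not exist, and then the value is unspecified.
\<close>

definition Xind :: "'a z2poset \<Rightarrow> int" where
  "Xind P = (if elems P = {} then -1
             else int (LEAST n. \<exists>\<phi>. op_z2_map P (cross_poset n) \<phi>))"

lemma (in free_z2poset) ex_op_z2_map_cross_poset:
  assumes fin: "finite (elems P)"
  shows "\<exists>n \<phi>. op_z2_map P (cross_poset n) \<phi>"
proof -
  define D where "D p = {q \<in> elems P. leq P q p \<and> q \<noteq> p}" for p
  define s where "s p = (if (SOME q. q \<in> {p, nu P p}) = p then 1 else - 1 :: int)" for p
  define \<phi> where "\<phi> p = s p * int (Suc (card (D p)))" for p
  have finD: "finite (D p)" for p
    using fin by (simp add: D_def)
  have D_sub: "D p \<subset> D q" if "p \<in> elems P" "q \<in> elems P" "leq P p q" "p \<noteq> q" for p q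
  proof -
    have "D p \<subseteq> D q"
    proof
      fix r assume "r \<in> D p"
      then have r: "r \<in> elems P" "leq P r p" "r \<noteq> p" by (auto simp: D_def)
      with that trans have "leq P r q" by (meson transp_onD)
      moreover have "r \<noteq> q" using r that antisym by (meson antisymp_onD)
      ultimately show "r \<in> D q" using r by (simp add: D_def)
    qed
    moreover have "p \<in> D q" "p \<notin> D p" using that by (auto simp: D_def)
    ultimately show ?thesis by blast
  qed
  have card_nu_le: "card (D p) \<le> card (D (nu P p))" if p: "p \<in> elems P" for p
  proof (rule card_inj_on_le[of "nu P"])
    show "inj_on (nu P) (D p)"
      by (rule inj_on_inverseI[of _ "nu P"]) (simp add: D_def nu_nu)
    show "nu P ` D p \<subseteq> D (nu P p)"
    proof
      fix r assume "r \<in> nu P ` D p"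
      then obtain q where q: "q \<in> elems P" "leq P q p" "q \<noteq> p" "r = nu P q"
        by (auto simp: D_def)
      have "leq P r (nu P p)" using q p nu_mono by (simp add: monotone_on_def)
      moreover have "r \<noteq> nu P p" using q p by (metis nu_nu)
      ultimately show "r \<in> D (nu P p)" using q by (simp add: D_def nu_closed)
    qed
  qed (rule finD)
  have card_nu: "card (D (nu P p)) = card (D p)" if p: "p \<in> elems P" for p
    using card_nu_le[OF p] card_nu_le[OF nu_closed[OF p]] nu_nu[OF p] by simp
  have s_nu: "s (nu P p) = - s p" if p: "p \<in> elems P" for p
  proof -
    have "(SOME q. q \<in> {p, nu P p}) \<in> {p, nu P p}" by (rule someI_ex) blast
    moreover have "{nu P p, nu P (nu P p)} = {p, nu P p}" using nu_nu[OF p] by auto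
    ultimately show ?thesis using nu_free[OF p] by (auto simp: s_def)
  qed
  have abs_phi: "\<bar>\<phi> p\<bar> = int (Suc (card (D p)))" for p
    by (simp add: \<phi>_def s_def)
  have "op_z2_map P (cross_poset (card (elems P))) \<phi>"
    unfolding op_z2_map_def
  proof (intro conjI ballI)
    have "card (D p) \<le> card (elems P)" for p
      by (rule card_mono[OF fin]) (auto simp: D_def)
    then show "\<phi> \<in> elems P \<rightarrow> elems (cross_poset (card (elems P)))"
      by (auto simp: cross_poset_def abs_phi)
    show "monotone_on (elems P) (leq P) (leq (cross_poset (card (elems P)))) \<phi>"
    proof (rule monotone_onI)
      fix p q assume "p \<in> elems P" "q \<in> elems P" "leq P p q"
      then have "p \<noteq> q \<Longrightarrow> card (D p) < card (D q)"
        using D_sub finD by (meson psubset_card_mono)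
      then show "leq (cross_poset (card (elems P))) (\<phi> p) (\<phi> q)"
        by (auto simp: cross_poset_def abs_phi)
    qed
    fix p assume "p \<in> elems P"
    then show "\<phi> (nu P p) = nu (cross_poset (card (elems P))) (\<phi> p)"
      by (simp add: \<phi>_def s_nu card_nu cross_poset_def)
  qed
  then show ?thesis by blast
qed

section \<open>The Hom complex of K2 into a graph\<close>

definition Hom_K2 :: "'v pair_pre_digraph \<Rightarrow> ('v set \<times> 'v set) z2poset" where
  "Hom_K2 G =
     \<lparr> elems = {(X, Y). X \<subseteq> pverts G \<and> Y \<subseteq> pverts G \<and> X \<noteq> {} \<and> Y \<noteq> {} \<and> X \<inter> Y = {} \<and>
                 (\<forall>x \<in> X. \<forall>y \<in> Y. (x, y) \<in> parcs G)},
       leq = (\<lambda>(X, Y) (X', Y'). X \<subseteq> X' \<and> Y \<subseteq> Y'),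
       nu = (\<lambda>(X, Y). (Y, X)) \<rparr>"

lemma free_z2poset_Hom_K2:
  assumes "pair_graph G"
  shows "free_z2poset (Hom_K2 G)"
proof -
  interpret pair_graph G by fact
  have "(v, u) \<in> parcs G" if "(u, v) \<in> parcs G" for u v
    using that pair_sym_arcs by (auto simp: symmetric_def sym_def)
  then show ?thesis
    by unfold_locales
      (auto simp: Hom_K2_def intro!: reflp_onI transp_onI antisymp_onI monotone_onI)
qed

lemma finite_elems_Hom_K2:
  assumes "pair_graph G"
  shows "finite (elems (Hom_K2 G))"
proof -
  interpret pair_graph G by fact
  have "elems (Hom_K2 G) \<subseteq> Pow (pverts G) \<times> Pow (pverts G)"
    by (auto simp: Hom_K2_def)
  then show ?thesis
    using pair_finite_verts by (meson finite_Pow_iff finite_SigmaI finite_subset)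
qed

end

theory Submission
  imports Defs
begin

text \<open>
  Let \<open>A\<close> represent the complement of \<open>G\<close>, let \<open>R\<close> be its row space and \<open>d = dim R\<close> its rank.
  To a vertex set \<open>X\<close> attach two subspaces of \<open>R\<close>: the span \<open>S X\<close> of the rows indexed by \<open>X\<close>
  (\<open>row_span\<close>), which grows with \<open>X\<close>, and the space \<open>Z X\<close> of the vectors of \<open>R\<close> that vanish on
  all coordinates in \<open>X\<close> (\<open>row_space_vanishing\<close>), which shrinks as \<open>X\<close> grows. For \<open>(X, Y)\<close> in
  the Hom complex, complete adjacency kills the blocks of \<open>A\<close> between \<open>X\<close> and \<open>Y\<close>, that is,
  \<open>S X \<subseteq> Z Y\<close> and \<open>S Y \<subseteq> Z X\<close>, while the nonzero diagonal keeps \<open>S X\<close> and \<open>S Y\<close> from being zero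
  and \<open>Z X\<close> and \<open>Z Y\<close> from being all of \<open>R\<close>. Hence the integer
  \<open>dim S X + dim S Y + (d - dim Z X) + (d - dim Z Y)\<close> lies between \<open>4\<close> and \<open>2 d\<close>
  (\<open>rank_level_range\<close>). It is monotone in \<open>(X, Y)\<close> and symmetric under the swap; having at most
  \<open>2 d - 3\<close> values, it can serve, up to a shift, as the absolute value of a map to \<open>Q\<^sub>n\<close> with
  \<open>n = 2 d - 4\<close>.

  It remains to choose signs. Going up in the Hom complex without raising the level leaves both
  \<open>S X\<close> and \<open>S Y\<close> unchanged (\<open>row_span_eq_if_rank_level_eq\<close>), so a sign that depends only on the
  ordered pair \<open>(S X, S Y)\<close> is constant along such steps. It can be chosen to change under the
  swap because \<open>S X \<noteq> S Y\<close> (\<open>row_span_neq_if_Hom_K2\<close>): for \<open>u \<in> X\<close>, the row of \<open>u\<close> would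
  otherwise lie in \<open>S Y \<subseteq> Z X\<close> and so have a zero diagonal entry. Thus
  \<open>Xind (Hom_K2 G) \<le> 2 d - 4\<close>, and the bound follows by taking \<open>A\<close> of minimum rank.
\<close>

text \<open>
  Here \<open>l\<close> provides the absolute values and \<open>k\<close> decides the signs: one of the two distinct keys
  \<open>k p\<close> and \<open>k (nu P p)\<close> is selected by a choice that depends on the unordered pair alone,
  and the sign of \<open>p\<close> records whether its own key is the selected one.
\<close>

lemma (in free_z2poset) ex_op_z2_map_cross_poset_if_level_key:
  fixes l :: "'a \<Rightarrow> int" and k :: "'a \<Rightarrow> 'b"
  assumes level_range: "\<And>p. p \<in> elems P \<Longrightarrow> 1 \<le> l p \<and> l p \<le> int n + 1"
    and level_mono: "\<And>p q. p \<in> elems P \<Longrightarrow> q \<in> elems P \<Longrightarrow> leq P p q \<Longrightarrow> l p \<le> l q"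
    and level_nu: "\<And>p. p \<in> elems P \<Longrightarrow> l (nu P p) = l p"
    and key_nu: "\<And>p. p \<in> elems P \<Longrightarrow> k (nu P p) \<noteq> k p"
    and key_eq: "\<And>p q. p \<in> elems P \<Longrightarrow> q \<in> elems P \<Longrightarrow> leq P p q \<Longrightarrow> l p = l q \<Longrightarrow> k p = k q"
  shows "\<exists>\<phi>. op_z2_map P (cross_poset n) \<phi>"
proof -
  define s where "s p = (if (SOME c. c \<in> {k p, k (nu P p)}) = k p then 1 else - 1 :: int)" for p
  define \<phi> where "\<phi> p = s p * l p" for p
  have abs_phi: "\<bar>\<phi> p\<bar> = l p" if "p \<in> elems P" for p
    using level_range[OF that] by (simp add: \<phi>_def s_def)
  have s_nu: "s (nu P p) = - s p" if p: "p \<in> elems P" for p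
  proof -
    have "(SOME c. c \<in> {k p, k (nu P p)}) \<in> {k p, k (nu P p)}" by (rule someI_ex) blast
    moreover have "{k (nu P p), k (nu P (nu P p))} = {k p, k (nu P p)}"
      using nu_nu[OF p] by auto
    ultimately show ?thesis using key_nu[OF p] by (auto simp: s_def)
  qed
  have s_eq: "s p = s q" if "p \<in> elems P" "q \<in> elems P" "leq P p q" "l p = l q" for p q
  proof -
    have "leq P (nu P p) (nu P q)" using that nu_mono by (simp add: monotone_on_def)
    then have "k (nu P p) = k (nu P q)" using that by (simp add: key_eq nu_closed level_nu)
    moreover have "k p = k q" using that by (rule key_eq)
    ultimately show ?thesis by (simp add: s_def)
  qed
  have "op_z2_map P (cross_poset n) \<phi>"
    unfolding op_z2_map_def
  proof (intro conjI ballI)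
    show "\<phi> \<in> elems P \<rightarrow> elems (cross_poset n)"
      using level_range by (auto simp: cross_poset_def abs_phi)
    show "monotone_on (elems P) (leq P) (leq (cross_poset n)) \<phi>"
    proof (rule monotone_onI)
      fix p q assume pq: "p \<in> elems P" "q \<in> elems P" "leq P p q"
      then consider "l p < l q" | "l p = l q" using level_mono by force
      then show "leq (cross_poset n) (\<phi> p) (\<phi> q)"
      proof cases
        case 1
        then show ?thesis using pq by (simp add: cross_poset_def abs_phi)
      next
        case 2
        then show ?thesis using s_eq[OF pq] by (simp add: cross_poset_def \<phi>_def)
      qed
    qed
    fix p assume "p \<in> elems P"
    then show "\<phi> (nu P p) = nu (cross_poset n) (\<phi> p)"
      by (simp add: \<phi>_def s_nu level_nu cross_poset_def)
  qed
  then show ?thesis by blast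
qed

lemma Xind_le_if_op_z2_map:
  assumes "op_z2_map P (cross_poset n) \<phi>"
  shows "Xind P \<le> int n"
  using assms by (auto simp: Xind_def intro: Least_le)

definition row_span :: "'f::field ^ 'm ^ 'n \<Rightarrow> 'n set \<Rightarrow> ('f ^ 'm) set" where
  "row_span A X = vec.span ((\<lambda>u. row u A) ` X)"

definition row_space_vanishing :: "'f::field ^ 'm ^ 'n \<Rightarrow> 'm set \<Rightarrow> ('f ^ 'm) set" where
  "row_space_vanishing A Y = {r \<in> vec.span (rows A). \<forall>v \<in> Y. r $ v = 0}"

lemma row_in_row_span: "u \<in> X \<Longrightarrow> row u A \<in> row_span A X"
  by (simp add: row_span_def vec.span_base)

lemma row_span_mono: "X \<subseteq> X' \<Longrightarrow> row_span A X \<subseteq> row_span A X'"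
  by (simp add: row_span_def vec.span_mono image_mono)

lemma row_space_vanishing_antimono:
  "Y \<subseteq> Y' \<Longrightarrow> row_space_vanishing A Y' \<subseteq> row_space_vanishing A Y"
  by (auto simp: row_space_vanishing_def)

lemma subspace_row_span: "vec.subspace (row_span A X)"
  by (simp add: row_span_def)

lemma subspace_row_space_vanishing: "vec.subspace (row_space_vanishing A Y)"
  by (auto simp: row_space_vanishing_def vec.subspace_def
      intro: vec.span_zero vec.span_add vec.span_scale)

text \<open>The right-hand side is a subspace, so it suffices that it contains the rows in \<open>X\<close>.\<close>

lemma row_span_subset_row_space_vanishing:
  assumes "\<And>u v. u \<in> X \<Longrightarrow> v \<in> Y \<Longrightarrow> A $ u $ v = 0"
  shows "row_span A X \<subseteq> row_space_vanishing A Y"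
  unfolding row_span_def
proof (rule vec.span_minimal[OF _ subspace_row_space_vanishing])
  show "(\<lambda>u. row u A) ` X \<subseteq> row_space_vanishing A Y"
    using assms by (auto simp: row_space_vanishing_def row_def rows_def intro!: vec.span_base)
qed

lemma dim_row_span_pos:
  assumes "u \<in> X" "A $ u $ v \<noteq> 0"
  shows "0 < vec.dim (row_span A X)"
proof -
  have "row u A $ v \<noteq> 0" using assms by (simp add: row_def)
  then have "row u A \<noteq> 0" by auto
  then have "\<not> row_span A X \<subseteq> {0}" using row_in_row_span[OF assms(1)] by blast
  then show ?thesis by (metis vec.dim_eq_0 gr0I)
qed

lemma dim_row_space_vanishing_less_rank:
  assumes "v \<in> Y" "A $ u $ v \<noteq> 0"
  shows "vec.dim (row_space_vanishing A Y) < rank A"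
proof -
  have "row u A \<in> vec.span (rows A)" by (auto simp: rows_def intro: vec.span_base)
  moreover have "row u A \<notin> row_space_vanishing A Y"
    using assms by (auto simp: row_space_vanishing_def row_def)
  ultimately have "row_space_vanishing A Y \<subset> vec.span (rows A)"
    by (auto simp: row_space_vanishing_def)
  then have "vec.dim (row_space_vanishing A Y) < vec.dim (rows A)"
    by (intro vec.dim_psubset)
      (simp add: vec.span_eq_iff[THEN iffD2, OF subspace_row_space_vanishing])
  then show ?thesis by (simp add: row_rank_def_gen)
qed

text \<open>
  The level is the sum of the four dimensions and codimensions attached to \<open>(X, Y)\<close>, shifted by
  \<open>3\<close> so that its least possible value \<open>4\<close> becomes \<open>1\<close>, the least absolute value in \<open>Q\<^sub>n\<close>.
\<close>

definition rank_level :: "'f::field ^ 'v ^ 'v \<Rightarrow> 'v::finite set \<times> 'v set \<Rightarrow> int" where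
  "rank_level A = (\<lambda>(X, Y).
     int (vec.dim (row_span A X)) + int (vec.dim (row_span A Y))
     + (int (rank A) - int (vec.dim (row_space_vanishing A X)))
     + (int (rank A) - int (vec.dim (row_space_vanishing A Y))) - 3)"

lemma rank_level_swap: "rank_level A (Y, X) = rank_level A (X, Y)"
  by (simp add: rank_level_def)

lemma rank_level_mono:
  assumes "X \<subseteq> X'" "Y \<subseteq> Y'"
  shows "rank_level A (X, Y) \<le> rank_level A (X', Y')"
proof -
  have "vec.dim (row_span A X) \<le> vec.dim (row_span A X')"
    "vec.dim (row_span A Y) \<le> vec.dim (row_span A Y')"
    "vec.dim (row_space_vanishing A X') \<le> vec.dim (row_space_vanishing A X)"
    "vec.dim (row_space_vanishing A Y') \<le> vec.dim (row_space_vanishing A Y)"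
    using assms by (simp_all add: vec.dim_subset row_span_mono row_space_vanishing_antimono)
  then show ?thesis by (simp add: rank_level_def)
qed

text \<open>
  Each of the four summands of the level is monotone, so none of them can change when the sum does
  not; nested subspaces of equal dimension coincide.
\<close>

lemma row_span_eq_if_rank_level_eq:
  assumes "X \<subseteq> X'" "Y \<subseteq> Y'" "rank_level A (X, Y) = rank_level A (X', Y')"
  shows "row_span A X = row_span A X'"
proof -
  have "vec.dim (row_span A Y) \<le> vec.dim (row_span A Y')"
    "vec.dim (row_space_vanishing A X') \<le> vec.dim (row_space_vanishing A X)"
    "vec.dim (row_space_vanishing A Y') \<le> vec.dim (row_space_vanishing A Y)"
    using assms by (simp_all add: vec.dim_subset row_span_mono row_space_vanishing_antimono)
  with assms(3) have "vec.dim (row_span A X') \<le> vec.dim (row_span A X)"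
    by (simp add: rank_level_def)
  then show ?thesis
    by (intro vec.subspace_dim_equal subspace_row_span row_span_mono assms(1))
qed

locale complement_representation = pair_graph G
  for G :: "'v::finite pair_pre_digraph" +
  fixes A :: "'f::field ^ 'v ^ 'v"
  assumes represents_complement: "represents A (complement_graph G)"
begin

lemma diagonal_nonzero: "u \<in> pverts G \<Longrightarrow> A $ u $ u \<noteq> 0"
  using represents_complement by (simp add: represents_def complement_graph_def)

lemma row_span_subset_if_Hom_K2:
  assumes "(X, Y) \<in> elems (Hom_K2 G)"
  shows "row_span A X \<subseteq> row_space_vanishing A Y"
proof (rule row_span_subset_row_space_vanishing)
  fix u v assume "u \<in> X" "v \<in> Y"
  with assms have "u \<in> pverts G" "v \<in> pverts G" "u \<noteq> v" "(u, v) \<in> parcs G"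
    by (auto simp: Hom_K2_def)
  then show "A $ u $ v = 0"
    using represents_complement by (simp add: represents_def complement_graph_def)
qed

lemma Hom_K2_swap: "(X, Y) \<in> elems (Hom_K2 G) \<Longrightarrow> (Y, X) \<in> elems (Hom_K2 G)"
  using free_z2poset.nu_closed[OF free_z2poset_Hom_K2[OF pair_graph_axioms], of "(X, Y)"]
  by (simp add: Hom_K2_def)

lemma row_span_neq_if_Hom_K2:
  assumes XY: "(X, Y) \<in> elems (Hom_K2 G)"
  shows "row_span A Y \<noteq> row_span A X"
proof
  assume eq: "row_span A Y = row_span A X"
  from XY obtain u where u: "u \<in> X" "u \<in> pverts G" by (auto simp: Hom_K2_def)
  then have "row u A \<in> row_space_vanishing A X"
    using eq row_in_row_span row_span_subset_if_Hom_K2[OF Hom_K2_swap[OF XY]] by blast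
  then have "A $ u $ u = 0" using u by (simp add: row_space_vanishing_def row_def)
  then show False using diagonal_nonzero u by blast
qed

text \<open>
  The lower bound comes from the nonzero diagonal, which makes each of the four summands positive.
  The upper bound holds because the dimension of the row span of \<open>X\<close> and the codimension of the
  vectors vanishing on \<open>Y\<close> add up to at most the rank, and likewise with \<open>X\<close> and \<open>Y\<close> exchanged.
\<close>

lemma rank_level_range:
  assumes XY: "(X, Y) \<in> elems (Hom_K2 G)"
  shows "1 \<le> rank_level A (X, Y) \<and> rank_level A (X, Y) \<le> 2 * int (rank A) - 3"
proof -
  have pos: "0 < vec.dim (row_span A W)" "vec.dim (row_space_vanishing A W) < rank A"
    if W: "W \<subseteq> pverts G" "W \<noteq> {}" for W
  proof -
    obtain w where "w \<in> W" "A $ w $ w \<noteq> 0" using W diagonal_nonzero by blast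
    then show "0 < vec.dim (row_span A W)" "vec.dim (row_space_vanishing A W) < rank A"
      by (auto intro: dim_row_span_pos dim_row_space_vanishing_less_rank)
  qed
  have sets: "X \<subseteq> pverts G" "X \<noteq> {}" "Y \<subseteq> pverts G" "Y \<noteq> {}"
    using XY by (auto simp: Hom_K2_def)
  have "vec.dim (row_span A X) \<le> vec.dim (row_space_vanishing A Y)"
    "vec.dim (row_span A Y) \<le> vec.dim (row_space_vanishing A X)"
    using XY by (simp_all add: vec.dim_subset row_span_subset_if_Hom_K2 Hom_K2_swap)
  then show ?thesis
    using pos[OF sets(1,2)] pos[OF sets(3,4)] by (simp add: rank_level_def)
qed

theorem Xind_Hom_K2_le_rank:
  assumes "parcs G \<noteq> {}"
  shows "Xind (Hom_K2 G) \<le> 2 * int (rank A) - 4"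
proof -
  interpret hom: free_z2poset "Hom_K2 G" by (rule free_z2poset_Hom_K2) (rule pair_graph_axioms)
  from assms obtain u v where "(u, v) \<in> parcs G" by auto
  then have "({u}, {v}) \<in> elems (Hom_K2 G)"
    using in_arcsD1[of u v] in_arcsD2[of u v] pair_no_loops[of "(u, v)"] by (auto simp: Hom_K2_def)
  \<comment> \<open>An edge makes the range of levels nonempty, so the subtraction below does not truncate.\<close>
  then have rank_ge: "2 \<le> rank A" using rank_level_range by fastforce
  define n where "n = 2 * rank A - 4"
  have n: "int n = 2 * int (rank A) - 4" using rank_ge by (simp add: n_def)
  have "\<exists>\<phi>. op_z2_map (Hom_K2 G) (cross_poset n) \<phi>"
  proof (rule hom.ex_op_z2_map_cross_poset_if_level_key
      [where l = "rank_level A" and k = "\<lambda>(X, Y). row_span A X"])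
    fix p q assume p: "p \<in> elems (Hom_K2 G)" and q: "q \<in> elems (Hom_K2 G)"
      and le: "leq (Hom_K2 G) p q"
    obtain X Y X' Y' where [simp]: "p = (X, Y)" "q = (X', Y')" by fastforce
    have sub: "X \<subseteq> X'" "Y \<subseteq> Y'" using le by (auto simp: Hom_K2_def)
    then show "rank_level A p \<le> rank_level A q" by (simp add: rank_level_mono)
    assume "rank_level A p = rank_level A q"
    then show "(case p of (X, Y) \<Rightarrow> row_span A X) = (case q of (X, Y) \<Rightarrow> row_span A X)"
      using row_span_eq_if_rank_level_eq[OF sub] by simp
  next
    fix p assume p: "p \<in> elems (Hom_K2 G)"
    obtain X Y where [simp]: "p = (X, Y)" by fastforce
    have [simp]: "nu (Hom_K2 G) (X, Y) = (Y, X)" by (simp add: Hom_K2_def)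
    show "1 \<le> rank_level A p \<and> rank_level A p \<le> int n + 1"
      using rank_level_range p n by simp
    show "rank_level A (nu (Hom_K2 G) p) = rank_level A p" by (simp add: rank_level_swap)
    show "(case nu (Hom_K2 G) p of (X, Y) \<Rightarrow> row_span A X) \<noteq> (case p of (X, Y) \<Rightarrow> row_span A X)"
      using row_span_neq_if_Hom_K2 p by simp
  qed
  then show ?thesis using Xind_le_if_op_z2_map n by metis
qed

end

theorem corollary3:
  fixes G :: "'v::finite pair_pre_digraph"
  assumes "pair_graph G"
    and "pverts G = UNIV"
    and "parcs G \<noteq> {}"
  shows "real (minrk TYPE('f::field) (complement_graph G))
           \<ge> 1 / 2 * real_of_int (Xind (Hom_K2 G)) + 2"
proof -
  obtain A :: "'f ^ 'v ^ 'v" where A: "represents A (complement_graph G)"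
    "rank A = minrk TYPE('f) (complement_graph G)"
    using minrk_attained by blast
  interpret complement_representation G A
    using assms(1) A(1) by (simp add: complement_representation_def complement_representation_axioms_def)
  have "Xind (Hom_K2 G) \<le> 2 * int (minrk TYPE('f) (complement_graph G)) - 4"
    using Xind_Hom_K2_le_rank[OF assms(3)] A(2) by simp
  then show ?thesis by linarith
qed

end
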